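(* Let $K\subset\mathbb R^m$, $m\in\mathbb N$, be a convex body (compact convex set) including the origin in its interior, and let $K^\circ$ be its polar. Then: (1) $K\in\mathcal C_m^0$ if and only if every proper exposed face of $K^\circ$ contains an exposed point of $K^\circ$. (2) $K\in\mathcal C_m$ if and only if every proper exposed face $F$ of $K^\circ$ contains $\dim(F)+1$ affinely independent exposed points of $K^\circ$. (3) $K\in\mathcal C_m'$ if and only if $K^\circ$ has no non-exposed points. (4) $K\in\mathcal C_m''$ if and only if $K^\circ$ has no non-exposed faces, if and only if $\mathcal N_K=\mathcal T_K$.
   Context: $\mathbb R^m$ carries the standard inner product $\langle\cdot,\cdot\rangle$. The polar of $K$ is $K^\circ:=\{u\in\mathbb R^m\mid\langle u,x\rangle\le1\text{ for all }x\in K\}$. The relative interior of a convex set is its interior in its affine hull. For a convex set $C\subset\mathbb R^m$ the normal cone of $C$ at $x\in C$ is $N_C(x):=\{u\in\mathbb R^m\mid \forall y\in C:\ \langle u,y-x\rangle\le 0\}$. For a non-empty convex subset $F\subset C$, $N_C(F):=N_C(x)$ for any relative interior point $x$ of $F$ (well-defined), and $N_C(\emptyset):=\mathbb R^m$. $\mathcal N_C$ denotes the set of normal cones of $C$ at points of $C$ together with $N_C(\emptyset)=\mathbb R^m$. A proper normal cone of $C$ is an element of $\mathcal N_C$ other than $N_C(\emptyset)$ and $N_C(C)$. A face of $C$ is a convex subset of $C$ containing every closed segment in $C$ whose relative interior it intersects. An exposed face of $C$ is either the empty set or the set of minimizers of a linear form on $C$ (the zero form is allowed, so $C$ is an exposed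 face). Exposed faces are faces; a non-exposed face is a face which is not an exposed face. A proper exposed face of $C$ is an exposed face other than $\emptyset$ and $C$. A point $x$ is an extreme (exposed, non-exposed) point of $C$ if $\{x\}$ is a face (exposed face, non-exposed face) of $C$. A ray is a set $\{\alpha u\mid\alpha\ge0\}$ with $u\ne0$; an extreme (exposed) ray of a convex cone is a face (exposed face) of it which is a ray. Rays are linearly independent if vectors spanning them are. If $u\in\mathbb R^m$ is such that $x\mapsto\langle x,u\rangle$ has a maximum on $C$, put $F:=\operatorname{argmax}_{x\in C}\langle x,u\rangle$; the touching cone of $C$ at $u$ is the face of $N_C(F)$ which contains $u$ in its relative interior. $\mathbb R^m$ is also a touching cone by definition. $\mathcal T_C$ is the set of touching cones of $C$. A proper convex subset of $\mathbb R^m$ is a convex subset of $\mathbb R^m$ with interior points which has a proper exposed face. The classes $\mathcal C_m^0,\mathcal C_m,\mathcal C_m',\mathcal C_m''$ consist of the proper convex subsets $C$ of $\mathbb R^m$ such that for every proper normal cone $N$ of $C$, respectively: ($\mathcal C_m^0$) $N$ has an exposed ray which is in $\mathcal N_C$; ($\mathcal C_m$) $N$ has $\dim(N)$ linearly independent exposed rays which are in $\mathcal N_C$; ($\mathcal C_m'$) every extreme ray of $N$ is in $\mathcal N_C$; ($\mathcal C_m''$) every non-empty face of $N$ is in $\mathcal N_C$. *)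

theory Defs
  imports "HOL-Analysis.Analysis"
begin

text \<open>
  Faces and exposed faces are \<^const>\<open>face_of\<close> and \<^const>\<open>exposed_face_of\<close>. In the latter the
  functional may be zero, so the empty set and the convex set itself are exposed faces.
\<close>

definition polar :: "'a::euclidean_space set \<Rightarrow> 'a set" where
  "polar K = {u. \<forall>x\<in>K. u \<bullet> x \<le> 1}"

definition normal_cone :: "'a::euclidean_space set \<Rightarrow> 'a \<Rightarrow> 'a set" where
  "normal_cone C x = {u. \<forall>y\<in>C. u \<bullet> (y - x) \<le> 0}"

text \<open>Intended for convex \<open>F \<subseteq> C\<close>; by the lemmas below the choice of the point is then irrelevant.\<close>

definition normal_cone_on :: "'a::euclidean_space set \<Rightarrow> 'a set \<Rightarrow> 'a set" where
  "normal_cone_on C F =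
     (if F = {} then UNIV else normal_cone C (SOME x. x \<in> rel_interior F))"

lemma normal_cone_antimono_rel_interior:
  assumes "convex F" "F \<subseteq> C" "x \<in> rel_interior F" "y \<in> F"
  shows "normal_cone C x \<subseteq> normal_cone C y"
proof
  fix u assume u: "u \<in> normal_cone C x"
  obtain e where e: "e > 1" "(1 - e) *\<^sub>R y + e *\<^sub>R x \<in> F"
    using assms convex_rel_interior_iff[of F x] by auto
  have "u \<bullet> (((1 - e) *\<^sub>R y + e *\<^sub>R x) - x) \<le> 0"
    using u e(2) assms(2) by (auto simp: normal_cone_def)
  then have "(e - 1) * (u \<bullet> (x - y)) \<le> 0"
    by (simp add: inner_simps algebra_simps)
  then have *: "u \<bullet> (x - y) \<le> 0"
    using e(1) by (simp add: mult_le_0_iff)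
  show "u \<in> normal_cone C y"
    unfolding normal_cone_def
  proof (intro CollectI ballI)
    fix z assume "z \<in> C"
    then have "u \<bullet> (z - x) \<le> 0"
      using u by (simp add: normal_cone_def)
    with * show "u \<bullet> (z - y) \<le> 0"
      by (simp add: inner_simps)
  qed
qed

lemma normal_cone_on_eq:
  assumes "convex F" "F \<subseteq> C" "x \<in> rel_interior F"
  shows "normal_cone_on C F = normal_cone C x"
proof -
  let ?y = "SOME y. y \<in> rel_interior F"
  have "?y \<in> rel_interior F"
    using assms(3) by (rule someI)
  then have "normal_cone C ?y = normal_cone C x"
    using normal_cone_antimono_rel_interior[OF assms(1,2)] assms(3) rel_interior_subset
    by (meson subset_antisym subsetD)
  moreover have "F \<noteq> {}"
    using assms(3) rel_interior_subset by auto
  ultimately show ?thesis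
    by (simp add: normal_cone_on_def)
qed

definition normal_cones :: "'a::euclidean_space set \<Rightarrow> 'a set set" where
  "normal_cones C = insert (normal_cone_on C {}) (normal_cone C ` C)"

definition proper_normal_cone :: "'a::euclidean_space set \<Rightarrow> 'a set \<Rightarrow> bool" where
  "proper_normal_cone C N \<longleftrightarrow>
     N \<in> normal_cones C \<and> N \<noteq> normal_cone_on C {} \<and> N \<noteq> normal_cone_on C C"

definition argmax_set :: "'a::euclidean_space set \<Rightarrow> 'a \<Rightarrow> 'a set" where
  "argmax_set C u = {x. is_arg_max (\<lambda>x. x \<bullet> u) (\<lambda>x. x \<in> C) x}"

text \<open>For convex \<open>C\<close> the \<open>T\<close> below is unique, by \<open>face_of_eq\<close>.\<close>

definition is_touching_cone_at :: "'a::euclidean_space set \<Rightarrow> 'a \<Rightarrow> 'a set \<Rightarrow> bool" where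
  "is_touching_cone_at C u T \<longleftrightarrow>
     argmax_set C u \<noteq> {} \<and>
     T face_of normal_cone_on C (argmax_set C u) \<and> u \<in> rel_interior T"

definition touching_cones :: "'a::euclidean_space set \<Rightarrow> 'a set set" where
  "touching_cones C = insert UNIV {T. \<exists>u. is_touching_cone_at C u T}"

definition proper_exposed_face_of :: "'a::euclidean_space set \<Rightarrow> 'a set \<Rightarrow> bool"
    (infixr \<open>(proper'_exposed'_face'_of)\<close> 50) where
  "F proper_exposed_face_of C \<longleftrightarrow> F exposed_face_of C \<and> F \<noteq> {} \<and> F \<noteq> C"

definition non_exposed_face_of :: "'a::euclidean_space set \<Rightarrow> 'a set \<Rightarrow> bool"
    (infixr \<open>(non'_exposed'_face'_of)\<close> 50) where
  "F non_exposed_face_of C \<longleftrightarrow> F face_of C \<and> \<not> F exposed_face_of C"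

definition exposed_point_of :: "'a::euclidean_space \<Rightarrow> 'a set \<Rightarrow> bool"
    (infixr \<open>(exposed'_point'_of)\<close> 50) where
  "x exposed_point_of C \<longleftrightarrow> {x} exposed_face_of C"

definition non_exposed_point_of :: "'a::euclidean_space \<Rightarrow> 'a set \<Rightarrow> bool"
    (infixr \<open>(non'_exposed'_point'_of)\<close> 50) where
  "x non_exposed_point_of C \<longleftrightarrow> {x} non_exposed_face_of C"

definition ray :: "'a::euclidean_space \<Rightarrow> 'a set" where
  "ray u = {\<alpha> *\<^sub>R u |\<alpha>. 0 \<le> \<alpha>}"

definition is_ray :: "'a::euclidean_space set \<Rightarrow> bool" where
  "is_ray R \<longleftrightarrow> (\<exists>u. u \<noteq> 0 \<and> R = ray u)"

definition extreme_ray_of :: "'a::euclidean_space set \<Rightarrow> 'a set \<Rightarrow> bool"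
    (infixr \<open>(extreme'_ray'_of)\<close> 50) where
  "R extreme_ray_of N \<longleftrightarrow> is_ray R \<and> R face_of N"

definition exposed_ray_of :: "'a::euclidean_space set \<Rightarrow> 'a set \<Rightarrow> bool"
    (infixr \<open>(exposed'_ray'_of)\<close> 50) where
  "R exposed_ray_of N \<longleftrightarrow> is_ray R \<and> R exposed_face_of N"

definition proper_convex :: "'a::euclidean_space set \<Rightarrow> bool" where
  "proper_convex C \<longleftrightarrow> convex C \<and> interior C \<noteq> {} \<and> (\<exists>F. F proper_exposed_face_of C)"

definition class_C0 :: "'a::euclidean_space set set" where
  "class_C0 = {C. proper_convex C \<and>
     (\<forall>N. proper_normal_cone C N \<longrightarrow> (\<exists>R. R exposed_ray_of N \<and> R \<in> normal_cones C))}"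

text \<open>\<open>B\<close> contains one spanning vector for each of the linearly independent rays.\<close>

definition class_C :: "'a::euclidean_space set set" where
  "class_C = {C. proper_convex C \<and>
     (\<forall>N. proper_normal_cone C N \<longrightarrow>
        (\<exists>B. independent B \<and> int (card B) = aff_dim N \<and>
             (\<forall>u\<in>B. ray u exposed_ray_of N \<and> ray u \<in> normal_cones C)))}"

definition class_C' :: "'a::euclidean_space set set" where
  "class_C' = {C. proper_convex C \<and>
     (\<forall>N. proper_normal_cone C N \<longrightarrow> (\<forall>R. R extreme_ray_of N \<longrightarrow> R \<in> normal_cones C))}"

definition class_C'' :: "'a::euclidean_space set set" where
  "class_C'' = {C. proper_convex C \<and>
     (\<forall>N. proper_normal_cone C N \<longrightarrow>
        (\<forall>F. F face_of N \<and> F \<noteq> {} \<longrightarrow> F \<in> normal_cones C))}"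

end

theory Submission
  imports Defs
begin

text \<open>
  Write \<open>P\<close> for the polar of the convex body \<open>K\<close>. For \<open>x \<in> K\<close> the hyperplane
  \<open>x \<bullet> u = 1\<close> supports \<open>P\<close> or misses it, and it cuts out the conjugate face of \<open>x\<close>. A nonzero
  normal vector of \<open>K\<close> at \<open>x\<close> takes its maximum over \<open>K\<close> at \<open>x\<close>, and this maximum is positive
  because 0 is interior. Scaled to maximum 1 the vector lies in the conjugate face. The
  normal cone at \<open>x\<close> is therefore the cone over the conjugate face (or \<open>{0}\<close> if that face is
  empty). By the bipolar theorem every proper exposed face of \<open>P\<close> arises in this way, so
  \<open>F \<mapsto> conic hull F\<close> maps the proper exposed faces of \<open>P\<close> onto the proper normal cones
  of \<open>K\<close> (\<open>proper_normal_cone_iff\<close>).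

  All four classes ask whether certain faces of a proper normal cone \<open>conic hull F\<close> are themselves
  normal cones. Since \<open>F\<close> lies in a hyperplane missing the origin, the faces of the cone, other
  than \<open>{}\<close> and \<open>{0}\<close>, are the cones over the nonempty faces \<open>G\<close> of \<open>F\<close>; rays correspond to
  points, and linear independence to affine independence. The decisive fact is
  \<open>conic_hull_in_normal_cones_iff\<close>: the cone over a nonempty \<open>G \<subseteq> F\<close> is a normal cone of \<open>K\<close>
  exactly if \<open>G\<close> is an exposed face of the whole of \<open>P\<close>. Each class condition thus becomes a
  condition on faces of \<open>P\<close>. Every nonempty proper face of \<open>P\<close> is a face of some proper exposed
  face (\<open>nonempty_proper_face_iff\<close>), so for the last two classes the condition ranges over all
  relevant faces of \<open>P\<close>.

  For touching cones, the point is that they are, apart from the whole space, just the nonempty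
  faces of the normal cones at points of \<open>K\<close> (\<open>touching_cones_eq_faces_of_normal_cones\<close>). Hence the equality of normal and touching
  cones restates the defining condition of the smallest class.
\<close>

section \<open>Cones over sets in an affine hyperplane missing the origin\<close>

lemma conic_hull_cases:
  assumes "p \<in> conic hull G" "p \<noteq> 0"
  obtains c g where "c > 0" "g \<in> G" "p = c *\<^sub>R g"
proof -
  obtain c g where cg: "0 \<le> c" "g \<in> G" "p = c *\<^sub>R g"
    using assms(1) by (auto simp: conic_hull_explicit)
  then have "0 < c"
    using assms(2) by (cases "c = 0") auto
  then show ?thesis
    using cg(2,3) by (rule that)
qed

lemma ray_eq_conic_hull: "ray u = conic hull {u}"
  by (auto simp: ray_def conic_hull_explicit)

lemma conic_hull_Int_hyperplane:
  assumes "G \<subseteq> {u. x \<bullet> u = 1}"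
  shows "conic hull G \<inter> {u. x \<bullet> u = 1} = G"
proof
  show "conic hull G \<inter> {u. x \<bullet> u = 1} \<subseteq> G"
    using assms by (auto simp: conic_hull_explicit)
  show "G \<subseteq> conic hull G \<inter> {u. x \<bullet> u = 1}"
    using assms hull_subset[of G conic] by auto
qed

text \<open>
  Scaling to \<open>x \<bullet> u = 1\<close> sends a segment between two nonzero points of the cone to a segment in
  \<open>F\<close>, with a reparametrised interior point. If an end point is 0, the other one is a positive
  multiple of the interior point.
\<close>

lemma conic_hull_face_of:
  assumes "F \<subseteq> {u. x \<bullet> u = 1}" "G face_of F"
  shows "(conic hull G) face_of (conic hull F)"
proof (cases "G = {}")
  case True
  then show ?thesis by simp
next
  case False
  have cone_mem: "c *\<^sub>R p \<in> conic hull G" if "p \<in> conic hull G" "0 \<le> c" for c p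
    using that conic_conic_hull[of G] by (auto simp: conic_def)
  have "a \<in> conic hull G \<and> b \<in> conic hull G"
    if a: "a \<in> conic hull F" and b: "b \<in> conic hull F" and p: "p \<in> conic hull G"
      and seg: "p \<in> open_segment a b" for a b p
  proof -
    obtain t where t: "0 < t" "t < 1" and pt: "p = (1 - t) *\<^sub>R a + t *\<^sub>R b"
      using seg by (auto simp: in_segment)
    show ?thesis
    proof (cases "a = 0 \<or> b = 0")
      case True
      have "b = (1/t) *\<^sub>R p" if "a = 0"
        using t pt that by simp
      moreover have "a = (1/(1-t)) *\<^sub>R p" if "b = 0"
        using t pt that by simp
      ultimately show ?thesis
        using True cone_mem[OF p, of "1/t"] cone_mem[OF p, of "1/(1-t)"] t False by auto
    next
      case nz: False
      obtain \<alpha> a' where a': "\<alpha> > 0" "a' \<in> F" "a = \<alpha> *\<^sub>R a'"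
        using conic_hull_cases[OF a] nz by auto
      obtain \<beta> b' where b': "\<beta> > 0" "b' \<in> F" "b = \<beta> *\<^sub>R b'"
        using conic_hull_cases[OF b] nz by auto
      have h: "x \<bullet> a' = 1" "x \<bullet> b' = 1"
        using a' b' assms(1) by auto
      \<comment> \<open>The parameter at which the scaled point divides the segment from a' to b'.\<close>
      define s where "s = t * \<beta> / ((1 - t) * \<alpha> + t * \<beta>)"
      have pos: "0 < (1 - t) * \<alpha>" "0 < t * \<beta>"
        using t a' b' by auto
      have xp: "x \<bullet> p = (1 - t) * \<alpha> + t * \<beta>"
        by (simp add: pt a' b' inner_simps h)
      have "(1 / (x \<bullet> p)) *\<^sub>R p \<in> conic hull G"
        using cone_mem[OF p] xp pos by auto
      moreover have "x \<bullet> ((1 / (x \<bullet> p)) *\<^sub>R p) = 1"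
        using xp pos by simp
      ultimately have g: "(1 / (x \<bullet> p)) *\<^sub>R p \<in> G"
        using conic_hull_Int_hyperplane[of G x] assms face_of_imp_subset by blast
      have s: "0 < s" "s < 1" "1 - s = (1 - t) * \<alpha> / (x \<bullet> p)" "s = t * \<beta> / (x \<bullet> p)"
        using pos by (auto simp: s_def xp field_simps)
      have "(1 / (x \<bullet> p)) *\<^sub>R p = (1 - s) *\<^sub>R a' + s *\<^sub>R b'"
        unfolding s(3) unfolding s(4) pt by (simp add: a' b' scaleR_add_right)
      with g have "(1 - s) *\<^sub>R a' + s *\<^sub>R b' \<in> G"
        by simp
      then have "a' \<in> G \<and> b' \<in> G"
      proof (cases "a' = b'")
        case True
        with \<open>(1 - s) *\<^sub>R a' + s *\<^sub>R b' \<in> G\<close> show ?thesis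
          by (simp add: scaleR_left_distrib[symmetric])
      next
        case False
        then have "(1 - s) *\<^sub>R a' + s *\<^sub>R b' \<in> open_segment a' b'"
          using s(1,2) by (auto simp: in_segment)
        then show ?thesis
          using face_ofD[OF assms(2)] a' b' \<open>(1 - s) *\<^sub>R a' + s *\<^sub>R b' \<in> G\<close> by blast
      qed
      then show ?thesis
        using cone_mem a' b' by (auto simp: hull_inc)
    qed
  qed
  moreover have "conic hull G \<subseteq> conic hull F" "convex (conic hull G)"
    using assms(2) by (auto simp: face_of_def intro!: convex_conic_hull dest: hull_mono)
  ultimately show ?thesis
    unfolding face_of_def by blast
qed

text \<open>
  Conversely a face of the cone is determined by its slice with the hyperplane, which is a face
  of \<open>F\<close>. The face \<open>{0}\<close> has to be excluded, because it is missed by the hyperplane.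
\<close>

lemma face_of_conic_hull_obtains:
  assumes F: "F \<subseteq> {u. x \<bullet> u = 1}"
    and T: "T face_of (conic hull F)" "T \<noteq> {}" "T \<noteq> {0}"
  obtains G where "G face_of F" "G \<noteq> {}" "T = conic hull G"
proof -
  have con: "conic T"
    using face_of_conic[OF conic_conic_hull T(1)] .
  have "T \<inter> {u. x \<bullet> u = 1} face_of F"
    using face_of_slice[OF T(1) convex_hyperplane[of x 1]] conic_hull_Int_hyperplane[OF F] by simp
  moreover
  have scale: "\<exists>c g. c \<ge> 0 \<and> g \<in> T \<inter> {u. x \<bullet> u = 1} \<and> u = c *\<^sub>R g" if u: "u \<in> T" "u \<noteq> 0" for u
  proof -
    have uF: "u \<in> conic hull F"
      using u(1) face_of_imp_subset[OF T(1)] by blast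
    obtain c f where f: "c > 0" "f \<in> F" "u = c *\<^sub>R f"
      by (rule conic_hull_cases[OF uF u(2)])
    have "f \<in> T"
      using conicD[OF con u(1), of "1/c"] f(1,3) by simp
    with f F have "c \<ge> 0 \<and> f \<in> T \<inter> {u. x \<bullet> u = 1} \<and> u = c *\<^sub>R f"
      by auto
    then show ?thesis
      by blast
  qed
  have "\<exists>u\<in>T. u \<noteq> 0"
    using T(2,3) by auto
  then have ne: "T \<inter> {u. x \<bullet> u = 1} \<noteq> {}"
    using scale by blast
  moreover have "T = conic hull (T \<inter> {u. x \<bullet> u = 1})"
  proof
    show "conic hull (T \<inter> {u. x \<bullet> u = 1}) \<subseteq> T"
      using con by (intro hull_minimal) auto
    show "T \<subseteq> conic hull (T \<inter> {u. x \<bullet> u = 1})"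
    proof
      fix u assume "u \<in> T"
      then show "u \<in> conic hull (T \<inter> {u. x \<bullet> u = 1})"
        using scale[of u] ne conic_hull_contains_0[of "T \<inter> {u. x \<bullet> u = 1}"]
        by (cases "u = 0") (auto simp: conic_hull_explicit)
    qed
  qed
  ultimately show ?thesis
    using that by blast
qed

lemma is_ray_nonempty: "is_ray R \<Longrightarrow> R \<noteq> {}"
  by (auto simp: is_ray_def ray_eq_conic_hull conic_hull_eq_empty)

lemma is_ray_subset_conic_hull:
  assumes "is_ray R" "R \<subseteq> conic hull F"
  obtains v where "v \<in> F" "R = ray v"
proof -
  obtain u where u: "u \<noteq> 0" "R = ray u"
    using assms(1) by (auto simp: is_ray_def)
  have uF: "u \<in> conic hull F"
    using u(2) assms(2) by (auto simp: ray_eq_conic_hull hull_inc)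
  obtain c v where v: "c > 0" "v \<in> F" "u = c *\<^sub>R v"
    by (rule conic_hull_cases[OF uF u(1)])
  have "R = ray v"
    using conic_hull_image_scale[of "{v}" "\<lambda>_. c"] v u(2) by (simp add: ray_eq_conic_hull)
  with v(2) that show ?thesis by blast
qed

text \<open>The affine hull of \<open>S\<close> misses 0, and adjoining 0 turns it into the span.\<close>

lemma dim_eq_aff_dim_plus_1:
  fixes S :: "'a::euclidean_space set"
  assumes "S \<subseteq> {u. x \<bullet> u = 1}"
  shows "int (dim S) = aff_dim S + 1"
proof -
  have "affine hull S \<subseteq> {u. x \<bullet> u = 1}"
    using assms affine_hyperplane by (rule hull_minimal)
  then have "0 \<notin> affine hull S"
    by auto
  then have "aff_dim (insert 0 S) = aff_dim S + 1"
    by (simp add: aff_dim_insert)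
  moreover have "aff_dim (insert 0 S) = int (dim (insert 0 S))"
    by (rule aff_dim_zero) (simp add: hull_inc)
  moreover have "span (insert 0 S) = span S"
    by simp
  then have "dim (insert 0 S) = dim S"
    by (metis dim_span)
  ultimately show ?thesis
    by simp
qed

lemma aff_dim_conic_hull:
  fixes F :: "'a::euclidean_space set"
  assumes "F \<subseteq> {u. x \<bullet> u = 1}" "F \<noteq> {}"
  shows "aff_dim (conic hull F) = aff_dim F + 1"
proof -
  have "conic hull F \<subseteq> span F"
    by (auto simp: conic_hull_explicit span_base span_scale)
  then have "span (conic hull F) = span F"
    using hull_subset[of F conic] by (metis span_mono span_span subset_antisym)
  then have "dim (conic hull F) = dim F"
    by (metis dim_span)
  moreover have "aff_dim (conic hull F) = int (dim (conic hull F))"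
    using assms(2) by (intro aff_dim_zero hull_inc[of 0 "conic hull F" affine]) simp
  ultimately show ?thesis
    using dim_eq_aff_dim_plus_1[OF assms(1)] by simp
qed

lemma independent_iff_finite_dim_card:
  fixes S :: "'a::euclidean_space set"
  shows "independent S \<longleftrightarrow> finite S \<and> dim S = card S"
proof
  assume "finite S \<and> dim S = card S"
  then show "independent S"
    using card_eq_dim[of S S] span_superset by auto
qed (simp add: independent_imp_finite dim_eq_card_independent)

lemma affine_dependent_iff_dependent:
  fixes S :: "'a::euclidean_space set"
  assumes "S \<subseteq> {u. x \<bullet> u = 1}"
  shows "affine_dependent S \<longleftrightarrow> dependent S"
  using dim_eq_aff_dim_plus_1[OF assms] affine_independent_iff_card[of S]
    independent_iff_finite_dim_card[of S] by auto

lemma independent_normalize: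
  fixes B :: "'a::euclidean_space set"
  assumes "independent B" "\<And>u. u \<in> B \<Longrightarrow> 0 < c u"
  shows "independent ((\<lambda>u. c u *\<^sub>R u) ` B)" "card ((\<lambda>u. c u *\<^sub>R u) ` B) = card B"
proof -
  let ?S = "(\<lambda>u. c u *\<^sub>R u) ` B"
  have fin: "finite B" and card: "card B = dim B"
    using assms(1) by (auto simp: independent_iff_finite_dim_card)
  have "B \<subseteq> span ?S"
  proof
    fix u assume u: "u \<in> B"
    then have "(1 / c u) *\<^sub>R (c u *\<^sub>R u) \<in> span ?S"
      by (intro span_scale span_base) auto
    then show "u \<in> span ?S"
      using assms(2)[OF u] by simp
  qed
  then have "dim B \<le> dim ?S"
    using dim_subset by (metis dim_span)
  moreover have "dim ?S \<le> card ?S" "card ?S \<le> card B"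
    using fin by (auto intro: dim_le_card' card_image_le)
  ultimately show "card ?S = card B" "independent ?S"
    using card fin by (auto simp: independent_iff_finite_dim_card)
qed

section \<open>Normal cones and touching cones\<close>

lemma normal_cone_on_empty: "normal_cone_on C {} = UNIV"
  by (simp add: normal_cone_on_def)

lemma zero_in_normal_cone: "0 \<in> normal_cone C x"
  by (simp add: normal_cone_def)

lemma convex_normal_cone: "convex (normal_cone C x)"
proof -
  have "normal_cone C x = (\<Inter>y\<in>C. {u. (y - x) \<bullet> u \<le> 0})"
    by (auto simp: normal_cone_def inner_commute)
  then show ?thesis
    by (simp add: convex_INT convex_halfspace_le)
qed

text \<open>A normal vector at \<open>x\<close> is normal at \<open>y\<close> exactly if it takes the same value at both points.\<close>

lemma normal_cone_Int_exposed_face: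
  assumes "x \<in> C" "y \<in> C"
  shows "(normal_cone C x \<inter> normal_cone C y) exposed_face_of normal_cone C x"
proof -
  have "u \<in> normal_cone C y \<longleftrightarrow> (y - x) \<bullet> u = 0" if u: "u \<in> normal_cone C x" for u
  proof
    assume "u \<in> normal_cone C y"
    then have "u \<bullet> (x - y) \<le> 0" "u \<bullet> (y - x) \<le> 0"
      using u assms by (auto simp: normal_cone_def)
    then show "(y - x) \<bullet> u = 0"
      by (simp add: inner_simps inner_commute)
  next
    assume "(y - x) \<bullet> u = 0"
    then show "u \<in> normal_cone C y"
      using u by (simp add: normal_cone_def inner_simps inner_commute)
  qed
  then have "normal_cone C x \<inter> normal_cone C y = normal_cone C x \<inter> {u. (y - x) \<bullet> u = 0}"
    by auto
  moreover have "(y - x) \<bullet> u \<le> 0" if "u \<in> normal_cone C x" for u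
    using that assms by (auto simp: normal_cone_def inner_commute)
  ultimately show ?thesis
    using exposed_face_of_Int_supporting_hyperplane_le[OF convex_normal_cone, of C x "y - x" 0]
    by simp
qed

lemma mem_argmax_set_iff: "x \<in> argmax_set C u \<longleftrightarrow> x \<in> C \<and> u \<in> normal_cone C x"
  by (auto simp: argmax_set_def is_arg_max_linorder normal_cone_def inner_simps inner_commute)

lemma convex_argmax_set:
  assumes "convex C"
  shows "convex (argmax_set C u)"
proof -
  have "argmax_set C u = C \<inter> (\<Inter>y\<in>C. {x. u \<bullet> x \<ge> u \<bullet> y})"
    by (auto simp: mem_argmax_set_iff normal_cone_def inner_simps)
  then show ?thesis
    using assms by (simp add: convex_Int convex_INT convex_halfspace_ge)
qed

text \<open>
  A nonempty face \<open>T\<close> of the normal cone at an arbitrary point \<open>x\<close> is the touching cone at any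
  relative interior point \<open>u\<close> of \<open>T\<close>. The definition uses the normal cone at a relatively interior
  point \<open>y\<close> of the maximizers of \<open>u\<close>; this cone is a face of the one at \<open>x\<close> and contains \<open>u\<close>, so it
  contains \<open>T\<close>, which is then a face of it.
\<close>

lemma touching_cones_eq_faces_of_normal_cones:
  fixes C :: "'a::euclidean_space set"
  assumes "convex C"
  shows "touching_cones C = insert UNIV {T. T \<noteq> {} \<and> (\<exists>x\<in>C. T face_of normal_cone C x)}"
proof -
  have rep: "\<exists>y\<in>rel_interior (argmax_set C u). y \<in> C \<and> u \<in> normal_cone C y \<and>
               normal_cone_on C (argmax_set C u) = normal_cone C y"
    if "argmax_set C u \<noteq> {}" for u
  proof -
    have cv: "convex (argmax_set C u)" and sub: "argmax_set C u \<subseteq> C"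
      using convex_argmax_set[OF assms] by (auto simp: mem_argmax_set_iff)
    obtain y where y: "y \<in> rel_interior (argmax_set C u)"
      using \<open>argmax_set C u \<noteq> {}\<close> rel_interior_eq_empty[OF cv] by auto
    then have "y \<in> argmax_set C u"
      using rel_interior_subset by blast
    then show ?thesis
      using y normal_cone_on_eq[OF cv sub y] by (auto simp: mem_argmax_set_iff)
  qed
  have "(\<exists>u. is_touching_cone_at C u T) \<longleftrightarrow> T \<noteq> {} \<and> (\<exists>x\<in>C. T face_of normal_cone C x)" for T
  proof (intro iffI conjI)
    assume "\<exists>u. is_touching_cone_at C u T"
    then obtain u where u: "argmax_set C u \<noteq> {}" "T face_of normal_cone_on C (argmax_set C u)"
        "u \<in> rel_interior T"
      by (auto simp: is_touching_cone_at_def)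
    then show "T \<noteq> {}"
      using rel_interior_subset by blast
    show "\<exists>x\<in>C. T face_of normal_cone C x"
      using rep[OF u(1)] u(2) by auto
  next
    assume "T \<noteq> {} \<and> (\<exists>x\<in>C. T face_of normal_cone C x)"
    then obtain x where T: "T \<noteq> {}" and x: "x \<in> C" "T face_of normal_cone C x"
      by auto
    obtain u where u: "u \<in> rel_interior T"
      using T rel_interior_eq_empty[OF face_of_imp_convex[OF x(2)]] by auto
    then have "u \<in> normal_cone C x"
      using x(2) face_of_imp_subset rel_interior_subset by blast
    then have xA: "x \<in> argmax_set C u"
      using x(1) by (simp add: mem_argmax_set_iff)
    then have ne: "argmax_set C u \<noteq> {}"
      by auto
    obtain y where y: "y \<in> rel_interior (argmax_set C u)" "y \<in> C" "u \<in> normal_cone C y"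
        "normal_cone_on C (argmax_set C u) = normal_cone C y"
      using rep[OF ne] by blast
    have sub: "normal_cone C y \<subseteq> normal_cone C x"
      using normal_cone_antimono_rel_interior[OF convex_argmax_set[OF assms] _ y(1) xA]
      by (metis mem_argmax_set_iff subsetI)
    then have "normal_cone C y face_of normal_cone C x"
      using normal_cone_Int_exposed_face[OF x(1) y(2)] by (simp add: Int_absorb1 exposed_face_of_def)
    then have "T \<subseteq> normal_cone C y"
      using u y(3) by (intro subset_of_face_of[OF _ face_of_imp_subset[OF x(2)]]) auto
    then have "T face_of normal_cone C y"
      using face_of_subset[OF x(2)] sub by blast
    then show "\<exists>u. is_touching_cone_at C u T"
      using ne u y(4) by (auto simp: is_touching_cone_at_def)
  qed
  then show ?thesis
    by (auto simp: touching_cones_def)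
qed

section \<open>Polars\<close>

definition conjugate_face :: "'a::euclidean_space set \<Rightarrow> 'a \<Rightarrow> 'a set" where
  "conjugate_face K x = polar K \<inter> {u. x \<bullet> u = 1}"

lemma convex_polar: "convex (polar K)"
proof -
  have "polar K = (\<Inter>x\<in>K. {u. x \<bullet> u \<le> 1})"
    by (auto simp: polar_def inner_commute)
  then show ?thesis
    by (simp add: convex_INT convex_halfspace_le)
qed

lemma zero_in_polar: "0 \<in> polar K"
  by (simp add: polar_def)

lemma zero_in_interior_polar:
  assumes "bounded K"
  shows "0 \<in> interior (polar K)"
proof -
  obtain r where r: "r > 0" "\<And>x. x \<in> K \<Longrightarrow> norm x \<le> r"
    using assms bounded_pos by blast
  have "ball 0 (1/r) \<subseteq> polar K"
  proof
    fix u assume "u \<in> ball (0::'a) (1/r)"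
    then have u: "norm u \<le> 1/r" by simp
    have "u \<bullet> x \<le> 1" if "x \<in> K" for x
    proof -
      have "u \<bullet> x \<le> norm u * norm x"
        by (rule norm_cauchy_schwarz)
      also have "\<dots> \<le> (1/r) * r"
        using u r that by (intro mult_mono) auto
      finally show ?thesis using r(1) by simp
    qed
    then show "u \<in> polar K"
      by (simp add: polar_def)
  qed
  then show ?thesis
    using r(1) by (meson centre_in_ball divide_pos_pos interior_maximal open_ball subsetD zero_less_one)
qed

text \<open>
  A hyperplane strictly separating a point from \<open>K\<close> misses 0, so it can be normalised to a
  vector of the polar that exceeds 1 at the point.
\<close>

theorem bipolar:
  fixes K :: "'a::euclidean_space set"
  assumes "convex K" "closed K" "0 \<in> K"
  shows "polar (polar K) = K"
proof
  show "K \<subseteq> polar (polar K)"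
    by (auto simp: polar_def inner_commute)
  show "polar (polar K) \<subseteq> K"
  proof (rule ccontr)
    assume "\<not> polar (polar K) \<subseteq> K"
    then obtain x where x: "x \<in> polar (polar K)" "x \<notin> K"
      by blast
    obtain a b where ab: "a \<bullet> x < b" "\<And>y. y \<in> K \<Longrightarrow> b < a \<bullet> y"
      using separating_hyperplane_closed_point[OF assms(1,2) x(2)] by blast
    have b: "b < 0"
      using ab(2)[OF assms(3)] by simp
    have "(1/b) *\<^sub>R a \<in> polar K"
      using ab(2) b by (auto simp: polar_def divide_simps less_imp_le)
    then have "x \<bullet> ((1/b) *\<^sub>R a) \<le> 1"
      using x(1) unfolding polar_def[of "polar K"] by blast
    then show False
      using ab(1) b by (simp add: field_simps inner_commute)
  qed
qed


text \<open>
  A hyperplane supporting \<open>S\<close> at a relative interior point of \<open>T\<close>, without containing the relative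
  interior of \<open>S\<close>, must contain \<open>T\<close>.
\<close>

lemma face_of_subset_proper_exposed_face:
  fixes S :: "'a::euclidean_space set"
  assumes "convex S" "T face_of S" "T \<noteq> {}" "T \<noteq> S"
  obtains F where "F proper_exposed_face_of S" "T \<subseteq> F"
proof -
  obtain x where x: "x \<in> rel_interior T"
    using assms(3) rel_interior_eq_empty[OF face_of_imp_convex[OF assms(2)]] by auto
  then have xT: "x \<in> T"
    using rel_interior_subset by blast
  then have xS: "x \<in> S" "x \<notin> rel_interior S"
    using face_of_disjoint_rel_interior[OF assms(2,4)] face_of_imp_subset[OF assms(2)] by auto
  obtain a where a: "\<And>y. y \<in> S \<Longrightarrow> a \<bullet> x \<le> a \<bullet> y"
      "\<And>y. y \<in> rel_interior S \<Longrightarrow> a \<bullet> x < a \<bullet> y"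
    by (rule supporting_hyperplane_rel_boundary[OF assms(1) xS]) blast
  let ?F = "S \<inter> {y. a \<bullet> y = a \<bullet> x}"
  obtain y where "y \<in> rel_interior S"
    using xS(1) rel_interior_eq_empty[OF assms(1)] by auto
  then have "y \<in> S" "y \<notin> ?F"
    using a(2)[of y] rel_interior_subset by auto
  moreover have F: "?F exposed_face_of S"
    using a(1) by (rule exposed_face_of_Int_supporting_hyperplane_ge[OF assms(1)])
  ultimately have "?F proper_exposed_face_of S"
    using xS(1) by (auto simp: proper_exposed_face_of_def)
  moreover have "T \<subseteq> ?F"
  proof (rule subset_of_face_of)
    show "?F face_of S"
      using F by (simp add: exposed_face_of_def)
    show "T \<subseteq> S"
      using assms(2) by (rule face_of_imp_subset)
    show "?F \<inter> rel_interior T \<noteq> {}"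
      using x xS(1) by auto
  qed
  ultimately show ?thesis
    by (rule that)
qed

section \<open>Normal cones of a convex body and exposed faces of its polar\<close>

locale convex_body =
  fixes K :: "'a::euclidean_space set"
  assumes convex: "convex K" and compact: "compact K" and zero_interior: "0 \<in> interior K"
begin

lemma zero_mem: "0 \<in> K"
  using zero_interior interior_subset by blast

lemma bipolar_eq: "polar (polar K) = K"
  using bipolar[OF convex compact_imp_closed[OF compact] zero_mem] .

lemma normal_cone_eq_conic_hull:
  assumes "x \<in> K"
  shows "normal_cone K x = insert 0 (conic hull (conjugate_face K x))"
proof (intro subset_antisym subsetI)
  fix u assume u: "u \<in> normal_cone K x"
  show "u \<in> insert 0 (conic hull (conjugate_face K x))"
  proof (cases "u = 0")
    case False
    have le: "u \<bullet> y \<le> u \<bullet> x" if "y \<in> K" for y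
      using u that by (auto simp: normal_cone_def inner_simps)
    \<comment> \<open>Some positive multiple of u lies in K because 0 is interior, so u attains a positive value.\<close>
    obtain r where r: "r > 0" "cball 0 r \<subseteq> K"
      using zero_interior by (auto simp: mem_interior_cball)
    have "(r / norm u) *\<^sub>R u \<in> K"
      using r False by (intro subsetD[OF r(2)]) auto
    from le[OF this] have "r * norm u \<le> u \<bullet> x"
      using False by (simp add: dot_square_norm power2_eq_square)
    moreover have "0 < r * norm u"
      using r(1) False by simp
    ultimately have pos: "u \<bullet> x > 0"
      by linarith
    then have "(1 / (u \<bullet> x)) *\<^sub>R u \<in> conjugate_face K x"
      using le by (auto simp: conjugate_face_def polar_def inner_commute)
    moreover have "u = (u \<bullet> x) *\<^sub>R ((1 / (u \<bullet> x)) *\<^sub>R u)"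
      using pos by simp
    ultimately have "u \<in> conic hull (conjugate_face K x)"
      using pos conicD[OF conic_conic_hull, of "(1 / (u \<bullet> x)) *\<^sub>R u" "conjugate_face K x" "u \<bullet> x"]
      by (simp add: hull_inc)
    then show ?thesis
      by simp
  qed simp
next
  fix u assume "u \<in> insert 0 (conic hull (conjugate_face K x))"
  then consider "u = 0" | c g where "c \<ge> 0" "g \<in> conjugate_face K x" "u = c *\<^sub>R g"
    by (auto simp: conic_hull_explicit)
  then show "u \<in> normal_cone K x"
  proof cases
    case 2
    have "g \<bullet> (y - x) \<le> 0" if "y \<in> K" for y
      using that 2(2) by (auto simp: conjugate_face_def polar_def inner_simps inner_commute)
    then show ?thesis
      using 2(1,3) by (auto simp: normal_cone_def mult_le_0_iff)
  qed (simp add: zero_in_normal_cone)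
qed

lemma conjugate_face_subset: "conjugate_face K x \<subseteq> {u. x \<bullet> u = 1}"
  by (simp add: conjugate_face_def)

text \<open>All nonzero normal vectors at \<open>x\<close> have a positive inner product with \<open>x\<close>.\<close>

lemma normal_cone_ne_UNIV:
  assumes "x \<in> K"
  shows "normal_cone K x \<noteq> UNIV"
proof
  assume eq: "normal_cone K x = UNIV"
  obtain b :: 'a where b: "b \<noteq> 0"
    using nonempty_Basis nonzero_Basis by (metis ex_in_conv)
  have "0 < x \<bullet> u" if "u \<noteq> 0" for u
  proof -
    have "u \<in> conic hull (conjugate_face K x)"
      using eq that normal_cone_eq_conic_hull[OF assms] by auto
    from this that obtain c g where "c > 0" "g \<in> conjugate_face K x" "u = c *\<^sub>R g"
      by (rule conic_hull_cases)
    then show ?thesis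
      by (simp add: conjugate_face_def)
  qed
  from this[of b] this[of "- b"] show False
    using b by simp
qed

lemma normal_cone_on_self: "normal_cone_on K K = {0}"
proof -
  have "0 \<in> rel_interior K"
    using zero_interior interior_subset_rel_interior[of K] by auto
  then have "normal_cone_on K K = normal_cone K 0"
    by (intro normal_cone_on_eq convex) auto
  also have "\<dots> = {0}"
    using normal_cone_eq_conic_hull[OF zero_mem] by (simp add: conjugate_face_def)
  finally show ?thesis .
qed

text \<open>
  A hyperplane \<open>a \<bullet> u = b\<close> supporting the polar has \<open>b > 0\<close>, since 0 is interior to the polar.
  Normalised to right-hand side 1, its normal vector \<open>a / b\<close> lies in the bipolar, which is \<open>K\<close>.
\<close>

lemma proper_exposed_face_of_polar_iff:
  "F proper_exposed_face_of polar K \<longleftrightarrow> F \<noteq> {} \<and> (\<exists>x\<in>K. F = conjugate_face K x)"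
proof
  assume F: "F proper_exposed_face_of polar K"
  then obtain a b where ab: "polar K \<subseteq> {u. a \<bullet> u \<le> b}" "F = polar K \<inter> {u. a \<bullet> u = b}" "a \<noteq> 0"
    by (auto simp: proper_exposed_face_of_def exposed_face_of)
  obtain r where r: "r > 0" "cball 0 r \<subseteq> polar K"
    using zero_in_interior_polar[OF compact_imp_bounded[OF compact]] by (auto simp: mem_interior_cball)
  have "(r / norm a) *\<^sub>R a \<in> polar K"
    using r ab(3) by (intro subsetD[OF r(2)]) auto
  then have "a \<bullet> ((r / norm a) *\<^sub>R a) \<le> b"
    using ab(1) by auto
  then have "r * norm a \<le> b"
    using ab(3) by (simp add: dot_square_norm power2_eq_square)
  moreover have "0 < r * norm a"
    using r(1) ab(3) by simp
  ultimately have b: "b > 0"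
    by linarith
  have "(1 / b) *\<^sub>R a \<in> polar (polar K)"
    unfolding polar_def[of "polar K"] using ab(1) b by (auto simp: field_simps)
  then have "(1 / b) *\<^sub>R a \<in> K"
    by (simp add: bipolar_eq)
  moreover have "F = conjugate_face K ((1 / b) *\<^sub>R a)"
    using ab(2) b by (auto simp: conjugate_face_def field_simps)
  ultimately show "F \<noteq> {} \<and> (\<exists>x\<in>K. F = conjugate_face K x)"
    using F by (auto simp: proper_exposed_face_of_def)
next
  assume "F \<noteq> {} \<and> (\<exists>x\<in>K. F = conjugate_face K x)"
  then obtain x where x: "x \<in> K" "F = conjugate_face K x" "F \<noteq> {}"
    by blast
  have "F exposed_face_of polar K"
    unfolding x(2) conjugate_face_def using x(1)
    by (intro exposed_face_of_Int_supporting_hyperplane_le convex_polar)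
       (auto simp: polar_def inner_commute)
  moreover have "0 \<notin> F"
    using x(2) by (simp add: conjugate_face_def)
  ultimately show "F proper_exposed_face_of polar K"
    using zero_in_polar x(3) by (auto simp: proper_exposed_face_of_def)
qed

lemma proper_exposed_face_obtains:
  assumes "F proper_exposed_face_of polar K"
  obtains x where "x \<in> K" "F = conjugate_face K x" "F \<subseteq> {u. x \<bullet> u = 1}"
    "normal_cone K x = conic hull F"
proof -
  obtain x where x: "x \<in> K" "F = conjugate_face K x" "F \<noteq> {}"
    using assms by (auto simp: proper_exposed_face_of_polar_iff)
  show ?thesis
  proof
    show "normal_cone K x = conic hull F"
      using x by (simp add: normal_cone_eq_conic_hull insert_absorb)
  qed (use x conjugate_face_subset in auto)
qed

theorem normal_cones_eq:
  "normal_cones K = insert UNIV (insert {0} {conic hull F |F. F proper_exposed_face_of polar K})"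
  (is "_ = ?R")
proof
  show "normal_cones K \<subseteq> ?R"
  proof
    fix N assume "N \<in> normal_cones K"
    then consider "N = UNIV" | x where "x \<in> K" "N = normal_cone K x"
      by (auto simp: normal_cones_def normal_cone_on_empty)
    then show "N \<in> ?R"
    proof cases
      case 2
      show ?thesis
      proof (cases "conjugate_face K x = {}")
        case True
        then show ?thesis
          using 2 by (simp add: normal_cone_eq_conic_hull)
      next
        case False
        then have "conjugate_face K x proper_exposed_face_of polar K"
          using 2(1) by (auto simp: proper_exposed_face_of_polar_iff)
        moreover have "N = conic hull (conjugate_face K x)"
          using 2 False by (simp add: normal_cone_eq_conic_hull insert_absorb)
        ultimately show ?thesis
          by blast
      qed
    qed simp
  qed
  have "{0} \<in> normal_cones K"
    using zero_mem by (auto simp: normal_cones_def normal_cone_eq_conic_hull conjugate_face_def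
        intro!: image_eqI[of _ _ 0])
  moreover have "conic hull F \<in> normal_cones K" if "F proper_exposed_face_of polar K" for F
    using proper_exposed_face_obtains[OF that] by (metis imageI insertCI normal_cones_def)
  ultimately show "?R \<subseteq> normal_cones K"
    by (auto simp: normal_cones_def normal_cone_on_empty)
qed

lemma conic_hull_proper_exposed_face_ne:
  assumes "F proper_exposed_face_of polar K"
  shows "conic hull F \<noteq> UNIV" "conic hull F \<noteq> {0}"
proof -
  obtain x where x: "x \<in> K" "F \<subseteq> {u. x \<bullet> u = 1}" "normal_cone K x = conic hull F"
    by (rule proper_exposed_face_obtains[OF assms])
  show "conic hull F \<noteq> UNIV"
    using normal_cone_ne_UNIV[OF x(1)] x(3) by simp
  obtain f where "f \<in> F"
    using assms by (auto simp: proper_exposed_face_of_def)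
  then have "f \<in> conic hull F" "f \<noteq> 0"
    using x(2) by (auto simp: hull_inc)
  then show "conic hull F \<noteq> {0}"
    by blast
qed

lemma proper_normal_cone_iff:
  "proper_normal_cone K N \<longleftrightarrow> (\<exists>F. F proper_exposed_face_of polar K \<and> N = conic hull F)"
proof -
  have "proper_normal_cone K N \<longleftrightarrow> N \<in> normal_cones K \<and> N \<noteq> UNIV \<and> N \<noteq> {0}"
    by (simp add: proper_normal_cone_def normal_cone_on_self normal_cone_on_empty)
  then show ?thesis
    using conic_hull_proper_exposed_face_ne by (auto simp: normal_cones_eq)
qed

text \<open>
  Slices of the cones over two conjugate faces are taken with different hyperplanes, but the polar
  meets each ray from 0 in at most one point at which some \<open>z \<in> K\<close> attains the value 1.
\<close>

lemma conic_hull_subset_imp_subset: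
  assumes "x \<in> K" "y \<in> K" "conic hull G \<subseteq> conic hull H"
    and "G \<subseteq> conjugate_face K x" "H \<subseteq> conjugate_face K y"
  shows "G \<subseteq> H"
proof
  fix g assume g: "g \<in> G"
  have gx: "g \<in> polar K" "x \<bullet> g = 1"
    using g assms(4) by (auto simp: conjugate_face_def)
  have "g \<in> conic hull H" "g \<noteq> 0"
    using g gx assms(3) by (auto simp: hull_inc)
  then obtain c h where h: "c > 0" "h \<in> H" "g = c *\<^sub>R h"
    by (rule conic_hull_cases)
  have hy: "h \<in> polar K" "y \<bullet> h = 1"
    using h(2) assms(5) by (auto simp: conjugate_face_def)
  \<comment> \<open>y bounds g = c h by 1, giving c at most 1, and x bounds h by 1, giving c at least 1.\<close>
  have "y \<bullet> g \<le> 1" "x \<bullet> h \<le> 1"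
    using gx(1) hy(1) assms(1,2) by (auto simp: polar_def inner_commute)
  moreover have "y \<bullet> g = c" "c * (x \<bullet> h) = 1"
    using gx(2) hy(2) h(3) by auto
  ultimately have "c = 1"
    using h(1) by (smt (verit) mult_left_le)
  with h show "g \<in> H"
    by simp
qed

text \<open>
  If the cone over \<open>G\<close> is a normal cone, it is the cone over some proper exposed face \<open>H\<close>, and the
  preceding lemma, applied in both directions, forces \<open>G = H\<close>. This makes exposedness in the polar,
  rather than in \<open>F\<close>, the right condition.
\<close>

theorem conic_hull_in_normal_cones_iff:
  assumes F: "F proper_exposed_face_of polar K" and G: "G \<subseteq> F" "G \<noteq> {}"
  shows "conic hull G \<in> normal_cones K \<longleftrightarrow> G exposed_face_of polar K"
proof -
  obtain x where x: "x \<in> K" "F = conjugate_face K x" "F \<subseteq> {u. x \<bullet> u = 1}"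
      "normal_cone K x = conic hull F"
    by (rule proper_exposed_face_obtains[OF F])
  have "0 \<notin> G"
    using G(1) x(3) by auto
  show ?thesis
  proof
    assume "conic hull G \<in> normal_cones K"
    moreover have "conic hull G \<subseteq> conic hull F"
      using G(1) by (rule hull_mono)
    then have "conic hull G \<noteq> UNIV"
      using conic_hull_proper_exposed_face_ne(1)[OF F] by auto
    moreover have "conic hull G \<noteq> {0}"
      using G(2) \<open>0 \<notin> G\<close> hull_subset[of G conic] by auto
    ultimately obtain H where H: "H proper_exposed_face_of polar K" "conic hull G = conic hull H"
      by (auto simp: normal_cones_eq)
    obtain y where y: "y \<in> K" "H = conjugate_face K y"
      by (rule proper_exposed_face_obtains[OF H(1)])
    have "G = H"
      using conic_hull_subset_imp_subset[OF x(1) y(1), of G H]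
        conic_hull_subset_imp_subset[OF y(1) x(1), of H G] G(1) H(2) x(2) y(2) by simp
    then show "G exposed_face_of polar K"
      using H(1) by (simp add: proper_exposed_face_of_def)
  next
    assume "G exposed_face_of polar K"
    then have "G proper_exposed_face_of polar K"
      using G(2) \<open>0 \<notin> G\<close> zero_in_polar by (auto simp: proper_exposed_face_of_def)
    then show "conic hull G \<in> normal_cones K"
      by (auto simp: normal_cones_eq)
  qed
qed

text \<open>
  Normal cones contained in a normal cone are automatically exposed faces of it. In the first two
  classes it thus suffices that the rays are normal cones.
\<close>

lemma conic_hull_exposed_face_of:
  assumes F: "F proper_exposed_face_of polar K" and G: "G \<subseteq> F" "G \<noteq> {}" "G exposed_face_of polar K"
  shows "(conic hull G) exposed_face_of (conic hull F)"
proof -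
  obtain x where x: "x \<in> K" "F \<subseteq> {u. x \<bullet> u = 1}" "normal_cone K x = conic hull F"
    by (rule proper_exposed_face_obtains[OF F])
  have "G proper_exposed_face_of polar K"
    using G F x(2) zero_in_polar[of K] by (auto simp: proper_exposed_face_of_def)
  then obtain y where y: "y \<in> K" "normal_cone K y = conic hull G"
    by (rule proper_exposed_face_obtains)
  show ?thesis
    using normal_cone_Int_exposed_face[OF x(1) y(1)] hull_mono[OF G(1), of conic]
    by (simp add: x(3) y(2) Int_absorb1)
qed

lemma proper_exposed_face_of_polar_imp_face_of:
  "F proper_exposed_face_of polar K \<Longrightarrow> F face_of polar K"
  by (simp add: proper_exposed_face_of_def exposed_face_of_def)

text \<open>An extreme point of \<open>K\<close> is a proper face and so lies in a proper exposed face.\<close>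

lemma proper_convex: "proper_convex K"
proof -
  obtain e where e: "e extreme_point_of K"
    using extreme_point_exists_convex[OF compact convex] zero_mem by blast
  then have "{e} face_of K"
    by (simp add: face_of_singleton)
  moreover have "{e} \<noteq> K"
    using zero_interior by (metis empty_iff interior_singleton)
  ultimately obtain F where "F proper_exposed_face_of K"
    using face_of_subset_proper_exposed_face[OF convex] by blast
  then show ?thesis
    using convex zero_interior by (auto simp: proper_convex_def)
qed

section \<open>The four classes\<close>

lemma exposed_normal_ray_iff:
  assumes F: "F proper_exposed_face_of polar K"
  shows "R exposed_ray_of (conic hull F) \<and> R \<in> normal_cones K \<longleftrightarrow>
         (\<exists>v\<in>F. R = ray v \<and> v exposed_point_of polar K)"
proof
  assume R: "R exposed_ray_of (conic hull F) \<and> R \<in> normal_cones K"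
  then have "is_ray R" "R \<subseteq> conic hull F"
    using face_of_imp_subset[of R] by (auto simp: exposed_ray_of_def exposed_face_of_def)
  then obtain v where v: "v \<in> F" "R = ray v"
    by (rule is_ray_subset_conic_hull)
  then show "\<exists>v\<in>F. R = ray v \<and> v exposed_point_of polar K"
    using R conic_hull_in_normal_cones_iff[OF F, of "{v}"]
    by (auto simp: ray_eq_conic_hull exposed_point_of_def)
next
  assume "\<exists>v\<in>F. R = ray v \<and> v exposed_point_of polar K"
  then obtain v where v: "v \<in> F" "R = ray v" "{v} exposed_face_of polar K"
    by (auto simp: exposed_point_of_def)
  have "v \<noteq> 0"
    by (rule proper_exposed_face_obtains[OF F]) (use v(1) in auto)
  then show "R exposed_ray_of (conic hull F) \<and> R \<in> normal_cones K"
    using v conic_hull_in_normal_cones_iff[OF F, of "{v}"] conic_hull_exposed_face_of[OF F, of "{v}"]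
    by (auto simp: exposed_ray_of_def is_ray_def ray_eq_conic_hull)
qed

theorem class_C0_iff:
  "K \<in> class_C0 \<longleftrightarrow>
     (\<forall>F. F proper_exposed_face_of polar K \<longrightarrow> (\<exists>x\<in>F. x exposed_point_of polar K))"
proof -
  have "K \<in> class_C0 \<longleftrightarrow> (\<forall>F. F proper_exposed_face_of polar K \<longrightarrow>
      (\<exists>R. R exposed_ray_of (conic hull F) \<and> R \<in> normal_cones K))"
    using proper_convex by (auto simp: class_C0_def proper_normal_cone_iff)
  also have "\<dots> \<longleftrightarrow> (\<forall>F. F proper_exposed_face_of polar K \<longrightarrow>
      (\<exists>R. \<exists>v\<in>F. R = ray v \<and> v exposed_point_of polar K))"
    by (simp only: exposed_normal_ray_iff cong: imp_cong)
  finally show ?thesis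
    by blast
qed

text \<open>
  Vectors spanning the rays can be scaled into \<open>F\<close>, which keeps them linearly independent. In the
  hyperplane of \<open>F\<close> this is affine independence, and the extra dimension of the cone accounts for
  the \<open>+ 1\<close>.
\<close>

lemma independent_exposed_rays_iff:
  assumes F: "F proper_exposed_face_of polar K"
  shows "(\<exists>B. independent B \<and> int (card B) = aff_dim (conic hull F) \<and>
            (\<forall>u\<in>B. ray u exposed_ray_of (conic hull F) \<and> ray u \<in> normal_cones K)) \<longleftrightarrow>
         (\<exists>S\<subseteq>F. \<not> affine_dependent S \<and> int (card S) = aff_dim F + 1 \<and>
            (\<forall>x\<in>S. x exposed_point_of polar K))"
    (is "?L \<longleftrightarrow> ?R")
proof -
  obtain x where x: "F \<subseteq> {u. x \<bullet> u = 1}"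
    by (rule proper_exposed_face_obtains[OF F])
  have dim: "aff_dim (conic hull F) = aff_dim F + 1"
    using aff_dim_conic_hull[OF x] F by (simp add: proper_exposed_face_of_def)
  show ?thesis
  proof
    assume ?L
    then obtain B where B: "independent B" "int (card B) = aff_dim F + 1"
        "\<And>u. u \<in> B \<Longrightarrow> \<exists>v\<in>F. ray u = ray v \<and> v exposed_point_of polar K"
      using exposed_normal_ray_iff[OF F] dim by auto
    define c where "c u = 1 / (x \<bullet> u)" for u
    have norm: "0 < c u \<and> c u *\<^sub>R u \<in> F \<and> c u *\<^sub>R u exposed_point_of polar K" if u: "u \<in> B" for u
    proof -
      obtain v where v: "v \<in> F" "ray u = ray v" "v exposed_point_of polar K"
        using B(3)[OF u] by blast
      have "u \<in> ray v"
        using v(2) by (metis hull_inc ray_eq_conic_hull singletonI)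
      then obtain a where a: "0 \<le> a" "u = a *\<^sub>R v"
        by (auto simp: ray_def)
      have "u \<noteq> 0"
        using u B(1) dependent_zero by blast
      then have "a \<noteq> 0" "x \<bullet> u = a"
        using a(2) v(1) x by auto
      then show ?thesis
        using a v by (auto simp: c_def)
    qed
    let ?S = "(\<lambda>u. c u *\<^sub>R u) ` B"
    have sub: "?S \<subseteq> F"
      using norm by auto
    moreover have "\<not> affine_dependent ?S"
      using independent_normalize(1)[OF B(1), of c] norm affine_dependent_iff_dependent[of ?S x] sub x
      by blast
    moreover have "int (card ?S) = aff_dim F + 1"
      using independent_normalize(2)[OF B(1), of c] norm B(2) by simp
    ultimately show ?R
      using norm by blast
  next
    assume ?R
    then obtain S where S: "S \<subseteq> F" "\<not> affine_dependent S" "int (card S) = aff_dim F + 1"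
        "\<forall>v\<in>S. v exposed_point_of polar K"
      by blast
    have "independent S"
      using S(1,2) x affine_dependent_iff_dependent[of S x] by blast
    moreover have "\<forall>u\<in>S. ray u exposed_ray_of (conic hull F) \<and> ray u \<in> normal_cones K"
      using S(1,4) exposed_normal_ray_iff[OF F] by blast
    ultimately show ?L
      using S(3) dim by auto
  qed
qed

theorem class_C_iff:
  "K \<in> class_C \<longleftrightarrow>
     (\<forall>F. F proper_exposed_face_of polar K \<longrightarrow>
        (\<exists>S\<subseteq>F. \<not> affine_dependent S \<and> int (card S) = aff_dim F + 1 \<and>
               (\<forall>x\<in>S. x exposed_point_of polar K)))"
proof -
  have "K \<in> class_C \<longleftrightarrow> (\<forall>F. F proper_exposed_face_of polar K \<longrightarrow>
      (\<exists>B. independent B \<and> int (card B) = aff_dim (conic hull F) \<and>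
         (\<forall>u\<in>B. ray u exposed_ray_of (conic hull F) \<and> ray u \<in> normal_cones K)))"
    using proper_convex by (auto simp: class_C_def proper_normal_cone_iff)
  then show ?thesis
    by (simp only: independent_exposed_rays_iff cong: imp_cong)
qed

lemma nonempty_proper_face_iff:
  "G face_of polar K \<and> G \<noteq> {} \<and> G \<noteq> polar K \<longleftrightarrow>
     G \<noteq> {} \<and> (\<exists>F. F proper_exposed_face_of polar K \<and> G face_of F)"
proof
  assume "G face_of polar K \<and> G \<noteq> {} \<and> G \<noteq> polar K"
  then have G: "G face_of polar K" "G \<noteq> {}" "G \<noteq> polar K"
    by auto
  obtain F where F: "F proper_exposed_face_of polar K" "G \<subseteq> F"
    by (rule face_of_subset_proper_exposed_face[OF convex_polar G])
  then have "G face_of F"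
    using face_of_subset[OF G(1)] face_of_imp_subset[OF proper_exposed_face_of_polar_imp_face_of] by simp
  then show "G \<noteq> {} \<and> (\<exists>F. F proper_exposed_face_of polar K \<and> G face_of F)"
    using F G by blast
next
  assume "G \<noteq> {} \<and> (\<exists>F. F proper_exposed_face_of polar K \<and> G face_of F)"
  then obtain F where F: "G \<noteq> {}" "F proper_exposed_face_of polar K" "G face_of F"
    by blast
  then have "G face_of polar K"
    using face_of_trans[OF F(3) proper_exposed_face_of_polar_imp_face_of[OF F(2)]] by simp
  moreover have "G \<noteq> polar K"
    using F(2,3) face_of_imp_subset[of G F] face_of_imp_subset[of F "polar K"]
    by (auto simp: proper_exposed_face_of_def exposed_face_of_def)
  ultimately show "G face_of polar K \<and> G \<noteq> {} \<and> G \<noteq> polar K"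
    using F(1) by blast
qed

text \<open>
  The last two classes differ only in the faces of the normal cones they admit: rays, or all of
  them. The predicate \<open>P\<close> stands for this choice. The face \<open>{0}\<close> imposes nothing, being the normal
  cone at interior points of \<open>K\<close>.
\<close>

lemma faces_of_normal_cones_iff:
  "(\<forall>F. F proper_exposed_face_of polar K \<longrightarrow>
      (\<forall>T. T face_of (conic hull F) \<and> T \<noteq> {} \<longrightarrow> P T \<longrightarrow> T \<in> normal_cones K)) \<longleftrightarrow>
   (\<forall>G. G non_exposed_face_of polar K \<longrightarrow> \<not> P (conic hull G))"
  (is "?L \<longleftrightarrow> ?R")
proof
  assume L: ?L
  show ?R
  proof (intro allI impI notI)
    fix G assume G: "G non_exposed_face_of polar K" and P: "P (conic hull G)"
    then have "G face_of polar K \<and> G \<noteq> {} \<and> G \<noteq> polar K"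
      using convex_polar[of K] by (auto simp: non_exposed_face_of_def)
    then obtain F where F: "F proper_exposed_face_of polar K" "G face_of F" "G \<noteq> {}"
      by (auto simp: nonempty_proper_face_iff)
    obtain x where "F \<subseteq> {u. x \<bullet> u = 1}"
      by (rule proper_exposed_face_obtains[OF F(1)])
    then have "(conic hull G) face_of (conic hull F)"
      using F(2) by (rule conic_hull_face_of)
    moreover have "conic hull G \<noteq> {}"
      using F(3) by (simp add: conic_hull_eq_empty)
    ultimately have "conic hull G \<in> normal_cones K"
      using L F(1) P by blast
    then show False
      using G conic_hull_in_normal_cones_iff[OF F(1) face_of_imp_subset[OF F(2)] F(3)]
      by (simp add: non_exposed_face_of_def)
  qed
next
  assume R: ?R
  show ?L
  proof (intro allI impI)
    fix F T
    assume F: "F proper_exposed_face_of polar K" and T: "T face_of (conic hull F) \<and> T \<noteq> {}" and P: "P T"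
    show "T \<in> normal_cones K"
    proof (cases "T = {0}")
      case False
      obtain x where "F \<subseteq> {u. x \<bullet> u = 1}"
        by (rule proper_exposed_face_obtains[OF F])
      then obtain G where G: "G face_of F" "G \<noteq> {}" "T = conic hull G"
        using T False face_of_conic_hull_obtains by blast
      then have "G exposed_face_of polar K"
        using R P F nonempty_proper_face_iff[of G] by (auto simp: non_exposed_face_of_def)
      then show ?thesis
        using conic_hull_in_normal_cones_iff[OF F face_of_imp_subset[OF G(1)] G(2)] G(3) by simp
    qed (simp add: normal_cones_eq)
  qed
qed

lemma class_C'_iff_non_exposed_faces:
  "K \<in> class_C' \<longleftrightarrow> (\<forall>G. G non_exposed_face_of polar K \<longrightarrow> \<not> is_ray (conic hull G))"
proof -
  have "K \<in> class_C' \<longleftrightarrow> (\<forall>F. F proper_exposed_face_of polar K \<longrightarrow>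
      (\<forall>T. T face_of (conic hull F) \<and> T \<noteq> {} \<longrightarrow> is_ray T \<longrightarrow> T \<in> normal_cones K))"
    using proper_convex is_ray_nonempty by (auto simp: class_C'_def proper_normal_cone_iff extreme_ray_of_def)
  then show ?thesis
    by (simp only: faces_of_normal_cones_iff)
qed

theorem class_C'_iff: "K \<in> class_C' \<longleftrightarrow> (\<nexists>x. x non_exposed_point_of polar K)"
proof -
  have "is_ray (conic hull G) \<longleftrightarrow> (\<exists>v. G = {v})" if "G non_exposed_face_of polar K" for G
  proof -
    have "G face_of polar K \<and> G \<noteq> {} \<and> G \<noteq> polar K"
      using that convex_polar[of K] by (auto simp: non_exposed_face_of_def)
    then obtain F where F: "F proper_exposed_face_of polar K" "G face_of F" "G \<noteq> {}"
      by (auto simp: nonempty_proper_face_iff)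
    obtain x where x: "F \<subseteq> {u. x \<bullet> u = 1}"
      by (rule proper_exposed_face_obtains[OF F(1)])
    then have Gx: "G \<subseteq> {u. x \<bullet> u = 1}"
      using face_of_imp_subset[OF F(2)] by blast
    show ?thesis
    proof
      assume "is_ray (conic hull G)"
      then obtain v where v: "v \<in> G" "conic hull G = conic hull {v}"
        by (metis is_ray_subset_conic_hull order_refl ray_eq_conic_hull)
      have "G = conic hull {v} \<inter> {u. x \<bullet> u = 1}"
        using conic_hull_Int_hyperplane[OF Gx] v(2) by simp
      also have "\<dots> = {v}"
        using v(1) Gx by (intro conic_hull_Int_hyperplane) auto
      finally show "\<exists>v. G = {v}" ..
    next
      assume "\<exists>v. G = {v}"
      then obtain v where v: "G = {v}" ..
      then have "v \<noteq> 0"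
        using Gx by auto
      then show "is_ray (conic hull G)"
        using v by (auto simp: is_ray_def ray_eq_conic_hull)
    qed
  qed
  then show ?thesis
    unfolding class_C'_iff_non_exposed_faces non_exposed_point_of_def by blast
qed

theorem class_C''_iff: "K \<in> class_C'' \<longleftrightarrow> (\<nexists>F. F non_exposed_face_of polar K)"
proof -
  have "K \<in> class_C'' \<longleftrightarrow> (\<forall>F. F proper_exposed_face_of polar K \<longrightarrow>
      (\<forall>T. T face_of (conic hull F) \<and> T \<noteq> {} \<longrightarrow> True \<longrightarrow> T \<in> normal_cones K))"
    using proper_convex by (auto simp: class_C''_def proper_normal_cone_iff)
  then show ?thesis
    by (simp only: faces_of_normal_cones_iff) simp
qed

theorem normal_cones_eq_touching_cones_iff:
  "normal_cones K = touching_cones K \<longleftrightarrow> K \<in> class_C''"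
proof -
  have ne: "normal_cone K x \<noteq> {}" for x
    using zero_in_normal_cone by blast
  have sub: "normal_cones K \<subseteq> touching_cones K"
    unfolding normal_cones_def touching_cones_eq_faces_of_normal_cones[OF convex] normal_cone_on_empty
    using ne face_of_refl[OF convex_normal_cone[of K]] by blast
  have "touching_cones K \<subseteq> normal_cones K \<longleftrightarrow> 
      (\<forall>x\<in>K. \<forall>T. T face_of normal_cone K x \<and> T \<noteq> {} \<longrightarrow> T \<in> normal_cones K)"
    by (auto simp: touching_cones_eq_faces_of_normal_cones[OF convex] normal_cones_def normal_cone_on_empty)
  also have "\<dots> \<longleftrightarrow> (\<forall>N. proper_normal_cone K N \<longrightarrow> 
      (\<forall>T. T face_of N \<and> T \<noteq> {} \<longrightarrow> T \<in> normal_cones K))"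
  proof (intro iffI ballI allI impI)
    fix N T assume "\<forall>x\<in>K. \<forall>T. T face_of normal_cone K x \<and> T \<noteq> {} \<longrightarrow> T \<in> normal_cones K"
      "proper_normal_cone K N" "T face_of N \<and> T \<noteq> {}"
    then show "T \<in> normal_cones K"
      by (auto simp: proper_normal_cone_def normal_cones_def normal_cone_on_empty)
  next
    fix x T
    assume N: "\<forall>N. proper_normal_cone K N \<longrightarrow> (\<forall>T. T face_of N \<and> T \<noteq> {} \<longrightarrow> T \<in> normal_cones K)"
      and x: "x \<in> K" and T: "T face_of normal_cone K x \<and> T \<noteq> {}"
    show "T \<in> normal_cones K"
    proof (cases "normal_cone K x = {0}")
      case True
      then have "T = {0}"
        using T face_of_imp_subset[of T "{0}"] by auto
      then show ?thesis
        by (simp add: normal_cones_eq)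
    next
      case False
      then have "proper_normal_cone K (normal_cone K x)"
        using x normal_cone_ne_UNIV[OF x]
        by (auto simp: proper_normal_cone_def normal_cones_def normal_cone_on_self normal_cone_on_empty)
      then show ?thesis
        using N T by blast
    qed
  qed
  also have "\<dots> \<longleftrightarrow> K \<in> class_C''"
    using proper_convex by (auto simp: class_C''_def)
  finally show ?thesis
    using sub by blast
qed

end

theorem theorem5p4:
  fixes K :: "(real ^ 'n) set"
  assumes "convex K" and "compact K" and "0 \<in> interior K"
  shows "(K \<in> class_C0 \<longleftrightarrow>
            (\<forall>F. F proper_exposed_face_of polar K \<longrightarrow> (\<exists>x\<in>F. x exposed_point_of polar K))) \<and>
         (K \<in> class_C \<longleftrightarrow>
            (\<forall>F. F proper_exposed_face_of polar K \<longrightarrow>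
               (\<exists>S\<subseteq>F. \<not> affine_dependent S \<and> int (card S) = aff_dim F + 1 \<and>
                      (\<forall>x\<in>S. x exposed_point_of polar K)))) \<and>
         (K \<in> class_C' \<longleftrightarrow> (\<nexists>x. x non_exposed_point_of polar K)) \<and>
         ((K \<in> class_C'' \<longleftrightarrow> (\<nexists>F. F non_exposed_face_of polar K)) \<and>
          ((\<nexists>F. F non_exposed_face_of polar K) \<longleftrightarrow> normal_cones K = touching_cones K))"
proof -
  interpret convex_body K
    using assms by unfold_locales
  show ?thesis
    using class_C0_iff class_C_iff class_C'_iff class_C''_iff normal_cones_eq_touching_cones_iff
    by blast
qed

end
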